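(* Let $V$ be a $3$-dimensional vector space over an infinite field $\mathbb{K}$ and $R$ be a $6$-dimensional subspace of $V\otimes V$. Then at least one of the following statements is true: (P1) there is a $1$-dimensional subspace $L\subset V$ such that $(V\otimes L)\oplus R=V\otimes V$ or $(L\otimes V)\oplus R=V\otimes V$; (P2) there is a $1$-dimensional subspace $L\subset V$ such that $V\otimes L\subset R$ or $L\otimes V\subset R$; (P3) there is an invertible linear map $T:V\to V$ such that $R=\mathrm{span}\{x\otimes Tx:x\in V\}$.
   Context: The notation $X\oplus R=V\otimes V$ for subspaces $X,R\subseteq V\otimes V$ means internal direct sum: $X+R=V\otimes V$ and $X\cap R=\{0\}$. *)

theory Defs
  imports "HOL-Analysis.Cartesian_Space"
begin

text \<open>
  Vector spaces over a field \<open>'k\<close> are given by a scalar multiplication on an additive group, as in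
  \<^theory>\<open>HOL.Vector_Spaces\<close>; the vector space is the whole type.
\<close>

definition bilinear_map ::
  "('k::field \<Rightarrow> 'a::ab_group_add \<Rightarrow> 'a) \<Rightarrow> ('k \<Rightarrow> 'b::ab_group_add \<Rightarrow> 'b) \<Rightarrow>
   ('k \<Rightarrow> 'c::ab_group_add \<Rightarrow> 'c) \<Rightarrow> ('a \<Rightarrow> 'b \<Rightarrow> 'c) \<Rightarrow> bool"
where
  "bilinear_map s1 s2 s3 f \<longleftrightarrow>
     (\<forall>x. Vector_Spaces.linear s2 s3 (f x)) \<and> (\<forall>y. Vector_Spaces.linear s1 s3 (\<lambda>x. f x y))"

definition factors_uniquely ::
  "('k::field \<Rightarrow> 'w::ab_group_add \<Rightarrow> 'w) \<Rightarrow> ('k \<Rightarrow> 'u::ab_group_add \<Rightarrow> 'u) \<Rightarrow>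
   ('a \<Rightarrow> 'b \<Rightarrow> 'w) \<Rightarrow> ('a \<Rightarrow> 'b \<Rightarrow> 'u) \<Rightarrow> bool"
where
  "factors_uniquely sW sU t f \<longleftrightarrow>
     (\<exists>!g. Vector_Spaces.linear sW sU g \<and> (\<forall>x y. g (t x y) = f x y))"

text \<open>
  The universal property of the tensor product. A definition in HOL cannot quantify over the types
  of all target spaces, so the property is demanded for the target \<open>'k\<close> only; the lemma
  \<open>tensor_product_universal\<close> below derives it for every target space of every type.
\<close>

definition is_tensor_product ::
  "('k::field \<Rightarrow> 'a::ab_group_add \<Rightarrow> 'a) \<Rightarrow> ('k \<Rightarrow> 'b::ab_group_add \<Rightarrow> 'b) \<Rightarrow>
   ('k \<Rightarrow> 'w::ab_group_add \<Rightarrow> 'w) \<Rightarrow> ('a \<Rightarrow> 'b \<Rightarrow> 'w) \<Rightarrow> bool"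
where
  "is_tensor_product s1 s2 sW t \<longleftrightarrow>
     bilinear_map s1 s2 sW t \<and>
     (\<forall>f. bilinear_map s1 s2 (*) f \<longrightarrow> factors_uniquely sW (*) t f)"

definition tensor_subspace ::
  "('k::field \<Rightarrow> 'w::ab_group_add \<Rightarrow> 'w) \<Rightarrow> ('a \<Rightarrow> 'b \<Rightarrow> 'w) \<Rightarrow> 'a set \<Rightarrow> 'b set \<Rightarrow> 'w set"
where
  "tensor_subspace sW t A B = module.span sW {t x y | x y. x \<in> A \<and> y \<in> B}"

definition internal_direct_sum :: "'w::ab_group_add set \<Rightarrow> 'w set \<Rightarrow> 'w set \<Rightarrow> bool"
where
  "internal_direct_sum X R W \<longleftrightarrow> {x + r | x r. x \<in> X \<and> r \<in> R} = W \<and> X \<inter> R = {0}"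

lemma vector_space_field: "vector_space ((*) :: 'k::field \<Rightarrow> 'k \<Rightarrow> 'k)"
  by unfold_locales (simp_all add: algebra_simps)

lemma bilinear_map_vector_spaces:
  assumes "bilinear_map s1 s2 s3 f"
  shows "vector_space s1" "vector_space s2" "vector_space s3"
  using assms unfolding bilinear_map_def Vector_Spaces.linear_def by blast+

lemma tensor_product_spans:
  assumes "is_tensor_product s1 s2 sW t"
  shows "module.span sW {t x y | x y. True} = UNIV"
proof (rule ccontr)
  have bt: "bilinear_map s1 s2 sW t" using assms by (simp add: is_tensor_product_def)
  interpret W: vector_space sW by (rule bilinear_map_vector_spaces(3)[OF bt])
  interpret K: vector_space "(*) :: 'a \<Rightarrow> 'a \<Rightarrow> 'a" by (rule vector_space_field)
  interpret WK: vector_space_pair sW "(*) :: 'a \<Rightarrow> 'a \<Rightarrow> 'a" ..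
  let ?S = "{t x y | x y. True}"
  assume "W.span ?S \<noteq> UNIV"
  then obtain w where w: "w \<notin> W.span ?S" by blast
  obtain B where B: "B \<subseteq> W.span ?S" "W.independent B" "W.span ?S \<subseteq> W.span B"
    by (rule W.basis_exists)
  have sB: "W.span B = W.span ?S"
    by (intro subset_antisym W.span_minimal B W.subspace_span)
  have iB: "W.independent (insert w B)" using B w by (intro W.independent_insertI) (auto simp only: sB)
  define g where "g = WK.construct (insert w B) (\<lambda>b. if b = w then 1 else 0)"
  have lg: "Vector_Spaces.linear sW (*) g" unfolding g_def by (rule WK.linear_construct[OF iB])
  have gw: "g w = 1" unfolding g_def by (simp add: WK.construct_basis[OF iB])
  have gB: "g b = 0" if "b \<in> B" for b
    using that w B(1) unfolding g_def by (subst WK.construct_basis[OF iB]) auto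
  have g0: "Vector_Spaces.linear sW (*) (\<lambda>_. 0 :: 'a)"
    by (rule WK.linear_zero)
  have gS: "g s = 0" if "s \<in> W.span B" for s
    using WK.linear_eq_on[OF lg g0 that] gB by simp
  have gt: "g (t x y) = 0" for x y
    by (rule gS) (auto simp: sB intro: W.span_base)
  have "bilinear_map s1 s2 (*) (\<lambda>_ _. 0 :: 'a)"
  proof -
    interpret V1: vector_space s1 by (rule bilinear_map_vector_spaces(1)[OF bt])
    interpret V2: vector_space s2 by (rule bilinear_map_vector_spaces(2)[OF bt])
    show ?thesis unfolding bilinear_map_def
      by (simp add: Vector_Spaces.linear_iff V1.vector_space_axioms V2.vector_space_axioms vector_space_field)
  qed
  then have "factors_uniquely sW (*) t (\<lambda>_ _. 0 :: 'a)"
    using assms by (simp add: is_tensor_product_def)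
  then obtain u where u:
    "\<forall>h. Vector_Spaces.linear sW (*) h \<and> (\<forall>x y. h (t x y) = (0 :: 'a)) \<longrightarrow> h = u"
    unfolding factors_uniquely_def by (rule ex1E) (erule that)
  have "g = u" by (rule u[rule_format]) (simp add: lg gt)
  moreover have "(\<lambda>_. 0) = u" by (rule u[rule_format]) (simp add: g0)
  ultimately have "g = (\<lambda>_. 0)" by simp
  with gw show False by simp
qed

lemma tensor_product_basis:
  assumes T: "is_tensor_product s1 s2 sW t"
    and B: "module.independent s1 B" "module.span s1 B = UNIV"
    and C: "module.independent s2 C" "module.span s2 C = UNIV"
  shows "inj_on (\<lambda>(b, c). t b c) (B \<times> C)"
    and "module.independent sW ((\<lambda>(b, c). t b c) ` (B \<times> C))"
    and "module.span sW ((\<lambda>(b, c). t b c) ` (B \<times> C)) = UNIV"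
proof -
  have bt: "bilinear_map s1 s2 sW t" using T by (simp add: is_tensor_product_def)
  interpret V1: vector_space s1 by (rule bilinear_map_vector_spaces(1)[OF bt])
  interpret V2: vector_space s2 by (rule bilinear_map_vector_spaces(2)[OF bt])
  interpret W: vector_space sW by (rule bilinear_map_vector_spaces(3)[OF bt])
  interpret K: vector_space "(*) :: 'a \<Rightarrow> 'a \<Rightarrow> 'a" by (rule vector_space_field)
  interpret V1K: vector_space_pair s1 "(*) :: 'a \<Rightarrow> 'a \<Rightarrow> 'a" ..
  interpret V2K: vector_space_pair s2 "(*) :: 'a \<Rightarrow> 'a \<Rightarrow> 'a" ..
  have tl: "Vector_Spaces.linear s2 sW (t x)" "Vector_Spaces.linear s1 sW (\<lambda>x. t x y)" for x y
    using bt by (auto simp: bilinear_map_def)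
  let ?E = "(\<lambda>(b, c). t b c) ` (B \<times> C)"
  have ex: "\<exists>g. Vector_Spaces.linear sW (*) g \<and>
      (\<forall>b'\<in>B. \<forall>c'\<in>C. g (t b' c') = (if b' = b \<and> c' = c then 1 else (0::'a)))"
    if "b \<in> B" "c \<in> C" for b c
  proof -
    let ?p = "\<lambda>x. V1.representation B x b" and ?q = "\<lambda>y. V2.representation C y c"
    have lp: "Vector_Spaces.linear s1 (*) ?p" by (rule V1.linear_representation[OF B])
    have lq: "Vector_Spaces.linear s2 (*) ?q" by (rule V2.linear_representation[OF C])
    have "bilinear_map s1 s2 (*) (\<lambda>x y. ?p x * ?q y)"
      unfolding bilinear_map_def
    proof safe
      fix x show "Vector_Spaces.linear s2 (*) (\<lambda>y. ?p x * ?q y)"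
        by (rule V2K.linear_compose_scale_right[OF lq])
    next
      fix y show "Vector_Spaces.linear s1 (*) (\<lambda>x. ?p x * ?q y)"
        using V1K.linear_compose_scale_right[OF lp, of "?q y"] by (simp add: mult.commute)
    qed
    then obtain g where "Vector_Spaces.linear sW (*) g" "\<forall>x y. g (t x y) = ?p x * ?q y"
      using T unfolding is_tensor_product_def factors_uniquely_def by blast
    then show ?thesis
      by (intro exI[of _ g]) (auto simp: V1.representation_basis[OF B(1)] V2.representation_basis[OF C(1)])
  qed
  show "inj_on (\<lambda>(b, c). t b c) (B \<times> C)"
  proof (rule inj_onI, clarify)
    fix b c b' c' assume *: "b \<in> B" "c \<in> C" "b' \<in> B" "c' \<in> C" "t b c = t b' c'"
    obtain g where "\<forall>b'\<in>B. \<forall>c'\<in>C. g (t b' c') = (if b' = b \<and> c' = c then 1 else (0::'a))"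
      using ex[OF *(1,2)] by blast
    with * show "b = b' \<and> c = c'" by (metis zero_neq_one)
  qed
  show "W.independent ?E"
  proof
    assume "W.dependent ?E"
    then obtain b c where bc: "b \<in> B" "c \<in> C" "t b c \<in> W.span (?E - {t b c})"
      unfolding W.dependent_def by auto
    interpret WK: vector_space_pair sW "(*) :: 'a \<Rightarrow> 'a \<Rightarrow> 'a" ..
    obtain g where g: "Vector_Spaces.linear sW (*) g"
      "\<forall>b'\<in>B. \<forall>c'\<in>C. g (t b' c') = (if b' = b \<and> c' = c then 1 else (0::'a))"
      using ex[OF bc(1,2)] by blast
    have "g (t b c) = 0"
      by (rule WK.linear_eq_on[OF g(1) WK.linear_zero bc(3)]) (use g(2) in auto)
    with g(2) bc show False by simp
  qed
  have "t x y \<in> W.span ?E" for x y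
  proof -
    have 1: "t b y \<in> W.span ?E" if "b \<in> B" for b
    proof -
      have "t b y \<in> t b ` V2.span C" using C by simp
      also have "\<dots> = W.span (t b ` C)"
        by (rule module_hom.span_image[OF module_hom_linearI[OF tl(1)], symmetric])
      also have "\<dots> \<subseteq> W.span ?E" by (rule W.span_mono) (use that in auto)
      finally show ?thesis .
    qed
    have "t x y \<in> (\<lambda>x. t x y) ` V1.span B" using B by simp
    also have "\<dots> = W.span ((\<lambda>x. t x y) ` B)"
      by (rule module_hom.span_image[OF module_hom_linearI[OF tl(2)], symmetric])
    also have "\<dots> \<subseteq> W.span ?E"
      by (rule W.span_minimal) (use 1 in auto)
    finally show ?thesis .
  qed
  then have "W.span {t x y | x y. True} \<subseteq> W.span ?E"
    by (intro W.span_minimal) auto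
  then show "W.span ?E = UNIV"
    unfolding tensor_product_spans[OF T] by (rule top.extremum_uniqueI)
qed

lemma tensor_product_universal:
  assumes T: "is_tensor_product s1 s2 sW t" and f: "bilinear_map s1 s2 sU f"
  shows "factors_uniquely sW sU t f"
proof -
  have bt: "bilinear_map s1 s2 sW t" using T by (simp add: is_tensor_product_def)
  interpret V1: vector_space s1 by (rule bilinear_map_vector_spaces(1)[OF bt])
  interpret V2: vector_space s2 by (rule bilinear_map_vector_spaces(2)[OF bt])
  interpret W: vector_space sW by (rule bilinear_map_vector_spaces(3)[OF bt])
  interpret U: vector_space sU by (rule bilinear_map_vector_spaces(3)[OF f])
  interpret WU: vector_space_pair sW sU ..
  interpret V1U: vector_space_pair s1 sU ..
  interpret V2U: vector_space_pair s2 sU ..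
  have tl: "Vector_Spaces.linear s2 sW (t x)" "Vector_Spaces.linear s1 sW (\<lambda>x. t x y)" for x y
    using bt by (auto simp: bilinear_map_def)
  have fl: "Vector_Spaces.linear s2 sU (f x)" "Vector_Spaces.linear s1 sU (\<lambda>x. f x y)" for x y
    using f by (auto simp: bilinear_map_def)
  obtain B where B0: "B \<subseteq> UNIV" "V1.independent B" "UNIV \<subseteq> V1.span B"
    by (rule V1.basis_exists)
  then have B: "V1.independent B" "V1.span B = UNIV" by (simp_all add: top.extremum_uniqueI)
  obtain C where C0: "C \<subseteq> UNIV" "V2.independent C" "UNIV \<subseteq> V2.span C"
    by (rule V2.basis_exists)
  then have C: "V2.independent C" "V2.span C = UNIV" by (simp_all add: top.extremum_uniqueI)
  let ?m = "\<lambda>(b, c). t b c"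
  let ?E = "?m ` (B \<times> C)"
  note E = tensor_product_basis[OF T B C]
  define g where "g = WU.construct ?E (\<lambda>e. (\<lambda>(b, c). f b c) (inv_into (B \<times> C) ?m e))"
  have lg: "Vector_Spaces.linear sW sU g"
    unfolding g_def by (rule WU.linear_construct[OF E(2)])
  have g1: "g (t b c) = f b c" if "b \<in> B" "c \<in> C" for b c
  proof -
    have e: "t b c = ?m (b, c)" by simp
    have "inv_into (B \<times> C) ?m (t b c) = (b, c)"
      unfolding e using that by (intro inv_into_f_f[OF E(1)]) auto
    moreover have "t b c \<in> ?E" using that by auto
    ultimately show ?thesis unfolding g_def by (simp add: WU.construct_basis[OF E(2)])
  qed
  have comp: "Vector_Spaces.linear s2 sU (\<lambda>y. g (t x y))" "Vector_Spaces.linear s1 sU (\<lambda>x. g (t x y))" for x y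
    using Vector_Spaces.linear_compose[OF tl(1)[of x] lg] Vector_Spaces.linear_compose[OF tl(2)[of y] lg]
    by (simp_all add: o_def)
  have g2: "g (t b y) = f b y" if "b \<in> B" for b y
    by (rule V2U.linear_eq_on[OF comp(1) fl(1), of _ C]) (use C that g1 in auto)
  have g3: "g (t x y) = f x y" for x y
    by (rule V1U.linear_eq_on[OF comp(2) fl(2), of _ B]) (use B g2 in auto)
  show ?thesis unfolding factors_uniquely_def
  proof (rule ex1I[of _ g])
    show "Vector_Spaces.linear sW sU g \<and> (\<forall>x y. g (t x y) = f x y)" using lg g3 by blast
    fix h assume h: "Vector_Spaces.linear sW sU h \<and> (\<forall>x y. h (t x y) = f x y)"
    show "h = g"
    proof
      fix w
      have "w \<in> W.span {t x y | x y. True}" using tensor_product_spans[OF T] by simp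
      then show "h w = g w"
        by (rule WU.linear_eq_on[of h g, rotated 2]) (use h lg g3 in auto)
    qed
  qed
qed

text \<open>The outer product of coordinate vectors, with values in matrices, is a tensor product.\<close>

lemma is_tensor_product_outer:
  "is_tensor_product ((*s) :: 'k::field \<Rightarrow> 'k ^ 'm \<Rightarrow> 'k ^ 'm) ((*s) :: 'k \<Rightarrow> 'k ^ 'n \<Rightarrow> 'k ^ 'n)
     (\<lambda>c M. \<chi> i. c *s (M $ i)) (\<lambda>x y. \<chi> i j. x $ i * y $ j)"
proof -
  define s where "s = (\<lambda>(c::'k) (M :: 'k ^ 'n ^ 'm). \<chi> i. c *s (M $ i))"
  define t where "t = (\<lambda>(x :: 'k ^ 'm) (y :: 'k ^ 'n). (\<chi> i j. x $ i * y $ j) :: 'k ^ 'n ^ 'm)"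
  have s [simp]: "s c M $ i $ j = c * M $ i $ j" for c M i j by (simp add: s_def)
  have t [simp]: "t x y $ i $ j = x $ i * y $ j" for x y i j by (simp add: t_def)
  interpret M: vector_space s
    by unfold_locales (simp_all add: vec_eq_iff distrib_left distrib_right mult.assoc)
  interpret K: vector_space "(*) :: 'k \<Rightarrow> 'k \<Rightarrow> 'k" by (rule vector_space_field)
  have b: "bilinear_map (*s) (*s) s t"
    unfolding bilinear_map_def
    by (auto simp: Vector_Spaces.linear_iff vec.vector_space_axioms M.vector_space_axioms
          vec_eq_iff distrib_left distrib_right mult_ac)
  have "factors_uniquely s (*) t f" if f: "bilinear_map (*s) (*s) (*) f"
    for f :: "'k ^ 'm \<Rightarrow> 'k ^ 'n \<Rightarrow> 'k"
  proof -
    interpret MK: vector_space_pair s "(*) :: 'k \<Rightarrow> 'k \<Rightarrow> 'k" ..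
    have fl: "module_hom (*s) (*) (f x)" "module_hom (*s) (*) (\<lambda>x. f x y)" for x y
      using f by (auto simp: bilinear_map_def module_hom_iff_linear)
    define g where "g M = (\<Sum>i\<in>UNIV. \<Sum>j\<in>UNIV. M $ i $ j * f (axis i 1) (axis j 1))" for M :: "'k ^ 'n ^ 'm"
    have lg: "Vector_Spaces.linear s (*) g"
      by (auto simp: Vector_Spaces.linear_iff M.vector_space_axioms vector_space_field g_def
          sum.distrib sum_distrib_left distrib_right mult.assoc)
    have gt: "g (t x y) = f x y" for x y
    proof -
      have "f x y = f (\<Sum>i\<in>UNIV. x $ i *s axis i 1) y"
        by (simp add: basis_expansion)
      also have "\<dots> = (\<Sum>i\<in>UNIV. x $ i * f (axis i 1) y)"
        by (simp only: module_hom.sum[OF fl(2)] module_hom.scale[OF fl(2)])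
      also have "\<dots> = (\<Sum>i\<in>UNIV. x $ i * f (axis i 1) (\<Sum>j\<in>UNIV. y $ j *s axis j 1))"
        by (simp add: basis_expansion)
      also have "\<dots> = (\<Sum>i\<in>UNIV. x $ i * (\<Sum>j\<in>UNIV. y $ j * f (axis i 1) (axis j 1)))"
        by (simp only: module_hom.sum[OF fl(1)] module_hom.scale[OF fl(1)])
      finally show ?thesis by (simp add: g_def sum_distrib_left mult.assoc)
    qed
    have "h = g" if h: "Vector_Spaces.linear s (*) h" "\<forall>x y. h (t x y) = f x y" for h
    proof
      fix N :: "'k ^ 'n ^ 'm"
      have "N $ a $ b = (\<Sum>i\<in>UNIV. t (axis i 1) (N $ i)) $ a $ b" for a b
      proof -
        have "(\<Sum>i\<in>UNIV. t (axis i 1) (N $ i)) $ a $ b = (\<Sum>i\<in>UNIV. if i = a then N $ i $ b else 0)"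
          unfolding sum_component by (rule sum.cong) (auto simp: axis_def)
        then show ?thesis by (simp only: sum.delta finite_code UNIV_I if_True)
      qed
      then have "N = (\<Sum>i\<in>UNIV. t (axis i 1) (N $ i))"
        by (intro vec_eq_iff[THEN iffD2] allI)
      moreover have "h (\<Sum>i\<in>UNIV. t (axis i 1) (N $ i)) = g (\<Sum>i\<in>UNIV. t (axis i 1) (N $ i))"
        by (simp add: MK.linear_sum[OF h(1)] MK.linear_sum[OF lg] h(2) gt)
      ultimately show "h N = g N" by metis
    qed
    then show ?thesis unfolding factors_uniquely_def using lg gt by blast
  qed
  with b show ?thesis by (simp add: is_tensor_product_def s_def t_def)
qed

end

theory Submission
  imports Defs "HOL-Computational_Algebra.Polynomial"
begin

text \<open>
  Multiplication modulo \<open>R\<close> is a bilinear map \<open>(x, y) \<mapsto> x \<odot> y\<close> from \<open>V \<times> V\<close> onto a spanning set of the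
  3-dimensional space \<open>Q = (V \<otimes> V) / R\<close>. If (P1) fails, all left and right multiplications are
  singular; if (P2) fails, none of them vanishes except for the zero vector.

  No 2-dimensional \<open>U\<close> can satisfy \<open>V \<odot> U \<subseteq> \<ell>\<close> for a line \<open>\<ell>\<close>: singularity of the right
  multiplications by \<open>w + u\<close> for \<open>u \<in> U\<close> and \<open>w \<notin> U\<close> would produce a left annihilator of \<open>V\<close>. Hence
  some \<open>x\<^sub>0\<close> acts from the left with rank 2. Let \<open>k\<close> span its kernel. As \<open>x\<^sub>0 + t x\<close> acts singularly for
  all \<open>t\<close>, \<open>V \<odot> k\<close> lies in the plane \<open>x\<^sub>0 \<odot> V\<close>, and it equals that plane, since otherwise the
  determinant condition yields a forbidden \<open>U\<close>. In bases adapted to \<open>x\<^sub>0\<close> and \<open>k\<close>, the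
  identity \<open>det (y \<mapsto> x \<odot> y) = 0\<close>, compared coefficientwise, exhibits a linear isomorphism
  \<open>T\<close> with \<open>x \<odot> T x = 0\<close>. So \<open>R\<close> contains the span of all \<open>x \<otimes> T x\<close>, which has
  dimension at least 6.
\<close>

section \<open>Vector algebra in coordinates\<close>

definition dot3 :: "'k::field ^ 3 \<Rightarrow> 'k ^ 3 \<Rightarrow> 'k"
  where "dot3 a b = a $ 1 * b $ 1 + a $ 2 * b $ 2 + a $ 3 * b $ 3"

text \<open>Over every field this vanishes exactly when \<open>a\<close> and \<open>b\<close> are
  linearly dependent; \<open>cross a b \<noteq> 0\<close> serves below as independence of two
  vectors.\<close>

definition cross :: "'k::field ^ 3 \<Rightarrow> 'k ^ 3 \<Rightarrow> 'k ^ 3"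
  where "cross a b = vector [a $ 2 * b $ 3 - a $ 3 * b $ 2, a $ 3 * b $ 1 - a $ 1 * b $ 3,
    a $ 1 * b $ 2 - a $ 2 * b $ 1]"

text \<open>The determinant with columns \<open>a\<close>, \<open>b\<close>, \<open>c\<close>. Being
  nonzero, it certifies a basis.\<close>

definition triple :: "'k::field ^ 3 \<Rightarrow> 'k ^ 3 \<Rightarrow> 'k ^ 3 \<Rightarrow> 'k"
  where "triple a b c = dot3 (cross a b) c"

lemmas coord3 = triple_def dot3_def cross_def vector_3 vec_eq_iff forall_3

lemma dot3_simps [simp]:
  "dot3 a (b + c) = dot3 a b + dot3 a c" "dot3 a (k *s b) = k * dot3 a b" "dot3 a 0 = 0"
  by (simp_all add: coord3 algebra_simps)

lemma triple_simps [simp]: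
  "triple (a + a') b c = triple a b c + triple a' b c"
  "triple a (b + b') c = triple a b c + triple a b' c"
  "triple a b (c + c') = triple a b c + triple a b c'"
  "triple (k *s a) b c = k * triple a b c"
  "triple a (k *s b) c = k * triple a b c"
  "triple a b (k *s c) = k * triple a b c"
  "triple (a - a') b c = triple a b c - triple a' b c"
  "triple a (b - b') c = triple a b c - triple a b' c"
  "triple a b (c - c') = triple a b c - triple a b c'"
  "triple a a b = 0" "triple a b a = 0" "triple b a a = 0"
  "triple 0 a b = 0" "triple a 0 b = 0" "triple a b 0 = 0"
  by (simp_all add: coord3 algebra_simps)

lemma cross_swap: "cross b a = - cross a b"
  by (simp add: coord3 algebra_simps)

lemma triple_swap: "triple b a c = - triple a b c" "triple a c b = - triple a b c"
  by (simp_all add: coord3 algebra_simps)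

lemma cramer:
  assumes "triple a b c \<noteq> 0"
  shows "v = (triple v b c / triple a b c) *s a + (triple a v c / triple a b c) *s b
    + (triple a b v / triple a b c) *s c"
proof -
  have "triple a b c * v $ i
    = triple v b c * a $ i + triple a v c * b $ i + triple a b v * c $ i" for i
  proof -
    have "i = 1 \<or> i = 2 \<or> i = 3" by (rule exhaust_3)
    then show ?thesis by (elim disjE) (simp_all add: coord3 algebra_simps)
  qed
  then have "v $ i = (triple v b c * a $ i + triple a v c * b $ i + triple a b v * c $ i)
      / triple a b c" for i
    using assms by (metis nonzero_mult_div_cancel_left)
  then show ?thesis by (simp add: vec_eq_iff add_divide_distrib)
qed

lemma cross_zero_imp_multiple:
  assumes "cross a b = 0" "a \<noteq> 0"
  obtains c where "b = c *s a"
proof -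
  obtain i where i: "a $ i \<noteq> 0" using assms(2) by (auto simp: vec_eq_iff)
  have "a $ i * b $ j = b $ i * a $ j" for j
    using assms(1) exhaust_3[of i] exhaust_3[of j] by (elim disjE) (auto simp: coord3 algebra_simps)
  then have "b = (b $ i / a $ i) *s a"
    using i by (auto simp: vec_eq_iff field_simps)
  then show thesis by (rule that)
qed

text \<open>A unit vector at a nonzero coordinate of \<open>cross a b\<close> completes
  \<open>a\<close>, \<open>b\<close> to a basis; the Cramer coefficient of \<open>c\<close> along it
  is a multiple of \<open>triple a b c\<close>.\<close>

lemma triple_zero_imp_combination:
  assumes "triple a b c = 0" "cross a b \<noteq> 0"
  obtains p q where "c = p *s a + q *s b"
proof -
  obtain i where i: "cross a b $ i \<noteq> 0" using assms(2) by (auto simp: vec_eq_iff)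
  have D: "triple a b (axis i 1) \<noteq> 0"
    using i exhaust_3[of i] by (elim disjE) (auto simp: coord3 axis_def)
  show thesis
    using cramer[OF D, of c] assms(1) that by simp
qed

lemma ex_triple_nonzero:
  assumes "cross a b \<noteq> 0"
  obtains c where "triple a b c \<noteq> 0"
proof -
  obtain i where i: "cross a b $ i \<noteq> 0" using assms by (auto simp: vec_eq_iff)
  have "triple a b (axis i 1) \<noteq> 0"
    using i exhaust_3[of i] by (elim disjE) (auto simp: coord3 axis_def)
  then show thesis by (rule that)
qed

lemma ex_cross_nonzero:
  assumes "a \<noteq> 0"
  obtains b where "cross a b \<noteq> 0"
proof -
  have "cross a (axis 1 1) \<noteq> 0 \<or> cross a (axis 2 1) \<noteq> 0"
    using assms by (auto simp: coord3 axis_def)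
  then show thesis using that by blast
qed

lemma cross_simps [simp]:
  "cross (a + a') b = cross a b + cross a' b" "cross a (b + b') = cross a b + cross a b'"
  "cross (a - a') b = cross a b - cross a' b" "cross a (b - b') = cross a b - cross a b'"
  "cross (k *s a) b = k *s cross a b" "cross a (k *s b) = k *s cross a b"
  "cross a a = 0" "cross 0 a = 0" "cross a 0 = 0"
  by (simp_all add: coord3 algebra_simps)

lemma triple_nonzero_imp_cross: "triple a b c \<noteq> 0 \<Longrightarrow> cross a b \<noteq> 0"
  by (auto simp: triple_def dot3_def)

text \<open>Supplies a nonzero functional killing two vectors: \<open>cross a b\<close> when they
  are independent, otherwise a cross product with some independent vector.\<close>

lemma ex_orthogonal:
  fixes a b :: "'k::field ^ 3"
  obtains p where "p \<noteq> 0" "dot3 p a = 0" "dot3 p b = 0"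
proof -
  have *: "\<exists>p. p \<noteq> 0 \<and> dot3 p a = 0 \<and> dot3 p b = 0" if a: "a \<noteq> 0" for a b :: "'k ^ 3"
  proof (cases "cross a b = 0")
    case True
    obtain c where c: "b = c *s a" using cross_zero_imp_multiple[OF True a] .
    obtain d where d: "cross a d \<noteq> 0" using ex_cross_nonzero[OF a] .
    have "dot3 (cross a d) a = 0" by (simp add: coord3 algebra_simps)
    with c d show ?thesis by (intro exI[of _ "cross a d"]) simp
  next
    case False
    then show ?thesis by (intro exI[of _ "cross a b"]) (simp add: coord3 algebra_simps)
  qed
  show thesis
  proof (cases "a = 0")
    case True
    show thesis
    proof (cases "b = 0")
      case True
      show thesis by (rule that[of "axis 1 1"]) (simp_all add: \<open>a = 0\<close> True axis_eq_0_iff)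
    next
      case False
      with *[of b b] \<open>a = 0\<close> that show thesis by auto
    qed
  next
    case False
    with *[of a b] that show thesis by blast
  qed
qed

lemma vec3_expand:
  fixes a :: "'k::field ^ 3"
  shows "a = a $ 1 *s axis 1 1 + a $ 2 *s axis 2 1 + a $ 3 *s axis 3 1"
  by (simp add: coord3 axis_def)

text \<open>The determinant is multiplicative, and a kernel vector is a linear relation between the
  images of the unit vectors, so the determinant \<open>?D\<close> of \<open>L\<close> is
  zero.\<close>

lemma triple_singular:
  fixes L :: "'k::field ^ 3 \<Rightarrow> 'k ^ 3"
  assumes L: "Vector_Spaces.linear (*s) (*s) L" and v: "v \<noteq> 0" "L v = 0"
  shows "triple (L a) (L b) (L c) = 0"
proof -
  interpret L: Vector_Spaces.linear "(*s)" "(*s)" L by (rule L)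
  have e: "L a = a $ 1 *s L (axis 1 1) + a $ 2 *s L (axis 2 1) + a $ 3 *s L (axis 3 1)" for a
    using arg_cong[OF vec3_expand[of a], of L] by (simp add: L.add L.scale)
  let ?D = "triple (L (axis 1 1)) (L (axis 2 1)) (L (axis 3 1))"
  have "?D = 0"
  proof (rule ccontr)
    assume D: "?D \<noteq> 0"
    note z = e[of v, unfolded v(2), symmetric]
    have "v $ 1 = 0" using arg_cong[OF z, of "\<lambda>u. triple u (L (axis 2 1)) (L (axis 3 1))"] D by simp
    moreover have "v $ 2 = 0"
      using arg_cong[OF z, of "\<lambda>u. triple (L (axis 1 1)) u (L (axis 3 1))"] D by simp
    moreover have "v $ 3 = 0"
      using arg_cong[OF z, of "\<lambda>u. triple (L (axis 1 1)) (L (axis 2 1)) u"] D by simp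
    ultimately show False using v(1) by (simp add: vec_eq_iff forall_3)
  qed
  moreover have "triple (L a) (L b) (L c) = triple a b c * ?D"
    by (subst (1) e[of a], subst (1) e[of b], subst (1) e[of c]) (simp add: coord3 algebra_simps)
  ultimately show ?thesis by simp
qed

text \<open>A dependency among \<open>k\<close>, \<open>a\<close>, \<open>b\<close> loses its
  \<open>k\<close> term under \<open>L\<close> and would make \<open>L a\<close> and
  \<open>L b\<close> dependent.\<close>

lemma independent_with_kernel:
  fixes L :: "'k::field ^ 3 \<Rightarrow> 'k ^ 3"
  assumes L: "Vector_Spaces.linear (*s) (*s) L" and k: "k \<noteq> 0" "L k = 0"
    and ab: "cross (L a) (L b) \<noteq> 0"
  shows "triple k a b \<noteq> 0"
proof
  interpret L: Vector_Spaces.linear "(*s)" "(*s)" L by (rule L)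
  assume D: "triple k a b = 0"
  show False
  proof (cases "cross k a = 0")
    case True
    then obtain c where "a = c *s k" using k(1) by (rule cross_zero_imp_multiple)
    with k ab show False by (simp add: L.scale)
  next
    case False
    with D obtain p q where "b = p *s k + q *s a" by (rule triple_zero_imp_combination)
    with k ab show False by (simp add: L.add L.scale)
  qed
qed

section \<open>Polynomial identities over an infinite field\<close>

lemma cubic_vanishes:
  fixes a b c d :: "'k::field"
  assumes inf: "infinite (UNIV :: 'k set)" and z: "\<And>t. a + b * t + c * t^2 + d * t^3 = 0"
  shows "a = 0 \<and> b = 0 \<and> c = 0 \<and> d = 0"
proof -
  have "poly [:a, b, c, d:] t = 0" for t
    using z[of t] by (simp add: algebra_simps power2_eq_square power3_eq_cube)
  then have "{t. poly [:a, b, c, d:] t = 0} = UNIV" by blast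
  then have "[:a, b, c, d:] = 0" using inf poly_roots_finite by metis
  then show ?thesis by simp
qed

text \<open>Multiplying by \<open>t\<close> makes the identity hold at \<open>t = 0\<close>
  too.\<close>

lemma quadratic_vanishes_off_zero:
  fixes a b c :: "'k::field"
  assumes inf: "infinite (UNIV :: 'k set)" and z: "\<And>t. t \<noteq> 0 \<Longrightarrow> a + b * t + c * t^2 = 0"
  shows "a = 0"
proof -
  have "0 + a * t + b * t^2 + c * t^3 = 0" for t
  proof (cases "t = 0")
    case False
    have "0 + a * t + b * t^2 + c * t^3 = t * (a + b * t + c * t^2)"
      by (simp add: algebra_simps power2_eq_square power3_eq_cube)
    then show ?thesis using z[OF False] by simp
  qed simp
  from cubic_vanishes[OF inf this] show ?thesis by blast
qed

section \<open>Products with singular multiplications\<close>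

text \<open>Multiplication modulo \<open>R\<close> in coordinates. The singularity axioms negate
  (P1), the faithfulness axioms negate (P2); \<open>spanning\<close> says that no nonzero functional
  kills all products.\<close>

locale degenerate_product =
  fixes m :: "'k::field ^ 3 \<Rightarrow> 'k ^ 3 \<Rightarrow> 'k ^ 3" (infixl "\<odot>" 70)
  assumes inf: "infinite (UNIV :: 'k set)"
    and bil: "bilinear_map (*s) (*s) (*s) (\<odot>)"
    and singular_left: "\<And>x. \<exists>y. y \<noteq> 0 \<and> x \<odot> y = 0"
    and singular_right: "\<And>y. \<exists>x. x \<noteq> 0 \<and> x \<odot> y = 0"
    and faithful_left: "\<And>x. x \<noteq> 0 \<Longrightarrow> \<exists>y. x \<odot> y \<noteq> 0"
    and faithful_right: "\<And>y. y \<noteq> 0 \<Longrightarrow> \<exists>x. x \<odot> y \<noteq> 0"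
    and spanning: "\<And>p. p \<noteq> 0 \<Longrightarrow> \<exists>x y. dot3 p (x \<odot> y) \<noteq> 0"
begin

lemma linear_l: "Vector_Spaces.linear (*s) (*s) ((\<odot>) x)"
  and linear_r: "Vector_Spaces.linear (*s) (*s) (\<lambda>x. x \<odot> y)"
  using bil by (auto simp: bilinear_map_def)

lemma prod_simps [simp]:
  "x \<odot> (y + z) = x \<odot> y + x \<odot> z" "(x + y) \<odot> z = x \<odot> z + y \<odot> z"
  "x \<odot> (k *s y) = k *s (x \<odot> y)" "(k *s x) \<odot> y = k *s (x \<odot> y)" "x \<odot> 0 = 0" "0 \<odot> x = 0"
    "x \<odot> (y - z) = x \<odot> y - x \<odot> z" "(x - y) \<odot> z = x \<odot> z - y \<odot> z"
    "x \<odot> (- y) = - (x \<odot> y)" "(- x) \<odot> y = - (x \<odot> y)"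
proof -
  interpret l: Vector_Spaces.linear "(*s)" "(*s)" "(\<odot>) x" for x by (rule linear_l)
  interpret r: Vector_Spaces.linear "(*s)" "(*s)" "\<lambda>x. x \<odot> y" for y by (rule linear_r)
  show "x \<odot> (y + z) = x \<odot> y + x \<odot> z" "(x + y) \<odot> z = x \<odot> z + y \<odot> z"
    "x \<odot> (k *s y) = k *s (x \<odot> y)" "(k *s x) \<odot> y = k *s (x \<odot> y)" "x \<odot> 0 = 0" "0 \<odot> x = 0"
    "x \<odot> (y - z) = x \<odot> y - x \<odot> z" "(x - y) \<odot> z = x \<odot> z - y \<odot> z"
    "x \<odot> (- y) = - (x \<odot> y)" "(- x) \<odot> y = - (x \<odot> y)"
    by (simp_all add: l.add r.add l.scale r.scale l.zero r.zero l.diff r.diff l.neg r.neg)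
qed

lemma triple_prod [simp]: "triple (x \<odot> a) (x \<odot> b) (x \<odot> c) = 0"
  using singular_left[of x] triple_singular[OF linear_l] by blast

text \<open>With \<open>w\<close> completing \<open>u\<close>, \<open>v\<close> to a basis, the left
  annihilator of \<open>w\<close> also annihilates \<open>u\<close> and \<open>v\<close>,
  contradicting faithfulness.\<close>

lemma not_compression:
  assumes u: "cross u v \<noteq> 0"
    and uf: "\<And>x. \<exists>c. x \<odot> u = c *s f" and vf: "\<And>x. \<exists>c. x \<odot> v = c *s f"
  shows False
proof -
  obtain w where w: "triple u v w \<noteq> 0" using ex_triple_nonzero[OF u] .
  \<comment> \<open>Since products span, \<open>V \<odot> w\<close> has dimension at least 2 modulo
    the line of \<open>f\<close>, so only one direction of left factors sends \<open>w\<close> into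
    that line.\<close>
  have par: "cross a b = 0" if ab: "\<exists>c. a \<odot> w = c *s f" "\<exists>c. b \<odot> w = c *s f" for a b
  proof (rule ccontr)
    assume "cross a b \<noteq> 0"
    then obtain z where z: "triple a b z \<noteq> 0" by (rule ex_triple_nonzero)
    obtain p where p: "p \<noteq> 0" "dot3 p f = 0" "dot3 p (z \<odot> w) = 0" by (rule ex_orthogonal)
    have pu: "dot3 p (x \<odot> u) = 0" "dot3 p (x \<odot> v) = 0" for x
      using uf[of x] vf[of x] p by auto
    have pab: "dot3 p (a \<odot> w) = 0" "dot3 p (b \<odot> w) = 0" using ab p by auto
    have "dot3 p (x \<odot> w) = 0" for x
      by (subst cramer[OF z, of x]) (simp add: pab p)
    then have "dot3 p (x \<odot> y) = 0" for x y
      by (subst cramer[OF w, of y]) (simp add: pu)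
    with spanning[OF p(1)] show False by blast
  qed
  obtain x where x: "x \<noteq> 0" "x \<odot> w = 0" using singular_right by blast
  \<comment> \<open>The left annihilator \<open>x'\<close> of \<open>w + v'\<close> sends
    \<open>w\<close> into the line of \<open>f\<close>, hence is a multiple of
    \<open>x\<close>.\<close>
  have kill: "x \<odot> v' = 0" if v': "\<And>x. \<exists>c. x \<odot> v' = c *s f" for v'
  proof -
    obtain x' where x': "x' \<noteq> 0" "x' \<odot> (w + v') = 0" using singular_right by blast
    obtain c where c: "x' \<odot> v' = c *s f" using v' by blast
    have "x' \<odot> w = (- c) *s f" using x'(2) c by (simp add: eq_neg_iff_add_eq_0)
    then have "cross x x' = 0" using x(2) by (intro par) (metis vector_smult_lzero, metis)
    then obtain k where k: "x' = k *s x" using x(1) by (rule cross_zero_imp_multiple)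
    have "k \<noteq> 0" using k x' by auto
    with k x'(2) x(2) show ?thesis by auto
  qed
  have "x \<odot> y = 0" for y
    by (subst cramer[OF w, of y]) (simp add: kill[OF uf] kill[OF vf] x(2))
  with faithful_left[OF x(1)] show False by blast
qed

text \<open>If all ranks were at most 1, comparing \<open>x\<close> with \<open>x + y\<close> would
  put \<open>y \<odot> u\<close> on the line of \<open>x \<odot> a\<close> for every
  \<open>u\<close> in the 2-dimensional kernel of \<open>x\<close>, which
  \<open>not_compression\<close> forbids.\<close>

lemma ex_rank_two: "\<exists>x a b. cross (x \<odot> a) (x \<odot> b) \<noteq> 0"
proof (rule ccontr)
  assume "\<not> ?thesis"
  then have r1: "cross (x \<odot> a) (x \<odot> b) = 0" for x a b by blast
  obtain x :: "'k ^ 3" where x: "x \<noteq> 0" using singular_left by blast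
  obtain a where a: "x \<odot> a \<noteq> 0" using faithful_left[OF x] by blast
  have "a \<noteq> 0" using a by auto
  then obtain b where ab: "cross a b \<noteq> 0" by (rule ex_cross_nonzero)
  obtain c where c: "triple a b c \<noteq> 0" using ex_triple_nonzero[OF ab] .
  obtain r where r: "x \<odot> b = r *s (x \<odot> a)" using r1 a by (rule cross_zero_imp_multiple)
  obtain s where s: "x \<odot> c = s *s (x \<odot> a)" using r1 a by (rule cross_zero_imp_multiple)
  let ?u = "b + (- r) *s a" and ?v = "c + (- s) *s a"
  have ku: "x \<odot> ?u = 0" "x \<odot> ?v = 0" by (simp_all add: r s)
  have "triple ?u ?v a \<noteq> 0" using c triple_swap(1)[of b a c] triple_swap(2)[of b a c] by simp
  then have "cross ?u ?v \<noteq> 0" by (rule triple_nonzero_imp_cross)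
  moreover have "\<exists>k. y \<odot> u = k *s (x \<odot> a)" if u: "x \<odot> u = 0" for u y
  proof -
    have "cross ((x + y) \<odot> a) ((x + y) \<odot> u) = 0" "cross (y \<odot> a) (y \<odot> u) = 0" by (rule r1)+
    then have "cross (x \<odot> a) (y \<odot> u) = 0" by (simp add: u)
    then show ?thesis using a by (metis cross_zero_imp_multiple)
  qed
  ultimately show False using not_compression ku by metis
qed

text \<open>This is the coefficient of \<open>t\<close> in the vanishing determinant of left
  multiplication by \<open>x + t *s y\<close>, evaluated at \<open>a\<close>, \<open>b\<close>,
  \<open>k\<close>.\<close>

lemma kernel_image:
  assumes "x \<odot> k = 0"
  shows "triple (x \<odot> a) (x \<odot> b) (y \<odot> k) = 0"
proof -
  have "0 + triple (x \<odot> a) (x \<odot> b) (y \<odot> k) * t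
      + (triple (x \<odot> a) (y \<odot> b) (y \<odot> k) + triple (y \<odot> a) (x \<odot> b) (y \<odot> k)) * t^2
      + 0 * t^3 = 0" for t
    using triple_prod[of "x + t *s y" a b k]
    by (simp add: assms algebra_simps power2_eq_square del: triple_prod) (simp add: algebra_simps)
  from cubic_vanishes[OF inf this] show ?thesis by blast
qed

text \<open>If \<open>V \<odot> k\<close> were only a line, spanned by \<open>f\<close>, the
  determinant condition would force either \<open>V \<odot> e\<close> into the same line or all
  products into one plane.\<close>

lemma kernel_image_rank_two:
  assumes k: "k \<noteq> 0" "x \<odot> k = 0" and r: "cross (x \<odot> a) (x \<odot> b) \<noteq> 0"
  shows "\<exists>y z. cross (y \<odot> k) (z \<odot> k) \<noteq> 0"
proof (rule ccontr)
  assume "\<not> ?thesis"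
  then have r1: "cross (y \<odot> k) (z \<odot> k) = 0" for y z by blast
  obtain x1 where x1: "x1 \<odot> k \<noteq> 0" using faithful_right[OF k(1)] by blast
  define f where "f = x1 \<odot> k"
  have f: "f \<noteq> 0" using x1 by (simp add: f_def)
  have kf: "\<exists>c. y \<odot> k = c *s f" for y
    using r1 x1 unfolding f_def by (metis cross_zero_imp_multiple)
  \<comment> \<open>By \<open>kernel_image\<close>, \<open>f\<close> lies in the image of
    \<open>x\<close>; its preimage \<open>e\<close> is read off from the coefficients.\<close>
  obtain p q where pq: "f = p *s (x \<odot> a) + q *s (x \<odot> b)"
    using triple_zero_imp_combination[OF kernel_image[OF k(2)] r] unfolding f_def by metis
  define e where "e = p *s a + q *s b"
  have e: "x \<odot> e = f" by (simp add: e_def pq)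
  have "cross f (x \<odot> a) \<noteq> 0 \<or> cross f (x \<odot> b) \<noteq> 0"
  proof (rule ccontr)
    assume "\<not> ?thesis"
    then have "q *s cross (x \<odot> b) (x \<odot> a) = 0" "p *s cross (x \<odot> a) (x \<odot> b) = 0"
      by (simp_all add: pq)
    then have "p = 0" "q = 0" using r cross_swap[of "x \<odot> b"] by auto
    with pq f show False by simp
  qed
  then obtain e2 where e2: "cross f (x \<odot> e2) \<noteq> 0" by blast
  define f2 where "f2 = x \<odot> e2"
  have D: "triple k e e2 \<noteq> 0"
    by (rule independent_with_kernel[OF linear_l k]) (use e e2 in simp)
  \<comment> \<open>The determinant of left multiplication by \<open>y\<close> is \<open>c\<close>
    times this value. Where \<open>c = 0\<close>, perturbing \<open>y\<close> by
    \<open>t *s x1\<close> makes the factor nonzero.\<close>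
  have z: "triple f (y \<odot> e) (y \<odot> e2) = 0" for y
  proof -
    have *: "triple f (y \<odot> e) (y \<odot> e2) = 0" if "y \<odot> k = c *s f" "c \<noteq> 0" for y c
      using triple_prod[of y k e e2] that by (simp del: triple_prod)
    obtain c where c: "y \<odot> k = c *s f" using kf by blast
    show ?thesis
    proof (cases "c = 0")
      case True
      show ?thesis
      proof (rule quadratic_vanishes_off_zero[OF inf])
        fix t :: 'k assume "t \<noteq> 0"
        then have "triple f ((y + t *s x1) \<odot> e) ((y + t *s x1) \<odot> e2) = 0"
          by (intro *[of _ t]) (simp_all add: c True f_def)
        then show "triple f (y \<odot> e) (y \<odot> e2)
            + (triple f (y \<odot> e) (x1 \<odot> e2) + triple f (x1 \<odot> e) (y \<odot> e2)) * t
            + triple f (x1 \<odot> e) (x1 \<odot> e2) * t^2 = 0"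
          by (simp add: algebra_simps power2_eq_square)
      qed
    next
      case False
      with * c show ?thesis by blast
    qed
  qed
  \<comment> \<open>Replace \<open>y\<close> by \<open>x + y\<close> in \<open>z\<close>, using
    \<open>x \<odot> e = f\<close> and \<open>x \<odot> e2 = f2\<close>.\<close>
  have z2: "triple f f2 (y \<odot> e) = 0" for y
    using z[of "x + y"] z[of y] e triple_swap(2)[of f f2] by (simp add: f2_def)
  obtain f3 where f3: "triple f f2 f3 \<noteq> 0" using ex_triple_nonzero e2 unfolding f2_def by blast
  \<comment> \<open>By \<open>z2\<close>, \<open>y \<odot> e\<close> is a combination of
    \<open>f\<close> and \<open>f2\<close>; in \<open>z\<close> only its \<open>f2\<close> part
    survives, giving a product of two scalars equal to zero.\<close>
  have alt: "triple f (y \<odot> e) f3 = 0 \<or> triple f f2 (y \<odot> e2) = 0" for y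
    using arg_cong[OF cramer[OF f3, of "y \<odot> e"], of "\<lambda>u. triple f u (y \<odot> e2)"] z[of y] f3
    by (simp add: z2)
  \<comment> \<open>A vector space is not the union of two proper subspaces.\<close>
  have "(\<forall>y. triple f (y \<odot> e) f3 = 0) \<or> (\<forall>y. triple f f2 (y \<odot> e2) = 0)"
  proof (rule ccontr)
    assume "\<not> ?thesis"
    then obtain y z where *: "triple f (y \<odot> e) f3 \<noteq> 0" "triple f f2 (z \<odot> e2) \<noteq> 0" by blast
    with alt[of y] alt[of z] alt[of "y + z"] show False by simp
  qed
  then show False
  proof
    assume *: "\<forall>y. triple f (y \<odot> e) f3 = 0"
    have "\<exists>c. y \<odot> e = c *s f" for y
      using cramer[OF f3, of "y \<odot> e"] * z2 by auto
    with not_compression[OF triple_nonzero_imp_cross[OF D]] kf show False by blast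
  next
    assume *: "\<forall>y. triple f f2 (y \<odot> e2) = 0"
    have "triple f f2 (y \<odot> k) = 0" for y using kf[of y] by auto
    then have "dot3 (cross f f2) (y \<odot> v) = 0" for y v
      unfolding triple_def[symmetric] by (subst cramer[OF D, of v]) (simp add: * z2)
    moreover have "cross f f2 \<noteq> 0" using e2 by (simp add: f2_def)
    ultimately show False using spanning by blast
  qed
qed

text \<open>In bases \<open>x0, x1, x2\<close> and \<open>k, e1, e2\<close>, the vanishing
  determinant fixes the structure constants well enough to write down a kernel vector of each left
  multiplication, linear in \<open>x\<close>.\<close>

lemma ex_annihilating_map:
  obtains T where "Vector_Spaces.linear (*s) (*s) T" "\<And>x. T x = 0 \<Longrightarrow> x = 0" "\<And>x. x \<odot> T x = 0"
proof -
  obtain x0 a b where r: "cross (x0 \<odot> a) (x0 \<odot> b) \<noteq> 0" using ex_rank_two by blast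
  obtain k where k: "k \<noteq> 0" "x0 \<odot> k = 0" using singular_left by blast
  obtain x1 x2 where x12: "cross (x1 \<odot> k) (x2 \<odot> k) \<noteq> 0"
    using kernel_image_rank_two[OF k r] by blast
  define f1 f2 where "f1 = x1 \<odot> k" and "f2 = x2 \<odot> k"
  have im: "\<exists>e. x0 \<odot> e = y \<odot> k" for y
  proof -
    obtain p q where "y \<odot> k = p *s (x0 \<odot> a) + q *s (x0 \<odot> b)"
      using triple_zero_imp_combination[OF kernel_image[OF k(2)] r] by metis
    then show ?thesis by (intro exI[of _ "p *s a + q *s b"]) simp
  qed
  obtain e1 e2 where e: "x0 \<odot> e1 = f1" "x0 \<odot> e2 = f2" using im unfolding f1_def f2_def by metis
  have Dx: "triple x0 x1 x2 \<noteq> 0"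
  proof (rule independent_with_kernel[OF linear_r[of k]])
    show "x0 \<noteq> 0" using r by auto
  qed (use k x12 in simp_all)
  have De: "triple k e1 e2 \<noteq> 0"
    by (rule independent_with_kernel[OF linear_l k]) (use e x12 in \<open>simp add: f1_def f2_def\<close>)
  obtain f3 where f3: "triple f1 f2 f3 \<noteq> 0"
    using ex_triple_nonzero x12 unfolding f1_def f2_def by blast
  have co: "\<exists>p q r. v = p *s f1 + q *s f2 + r *s f3" for v
    using cramer[OF f3, of v] by blast
  obtain M11 M21 r1 where m1: "x1 \<odot> e1 = M11 *s f1 + M21 *s f2 + r1 *s f3" using co by blast
  obtain M12 M22 r2 where m2: "x1 \<odot> e2 = M12 *s f1 + M22 *s f2 + r2 *s f3" using co by blast
  obtain N11 N21 s1 where n1: "x2 \<odot> e1 = N11 *s f1 + N21 *s f2 + s1 *s f3" using co by blast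
  obtain N12 N22 s2 where n2: "x2 \<odot> e2 = N12 *s f1 + N22 *s f2 + s2 *s f3" using co by blast
  note prods = k e m1 m2 n1 n2 f1_def[symmetric] f2_def[symmetric]
  have sw: "triple f1 f3 f2 = - triple f1 f2 f3" "triple f2 f1 f3 = - triple f1 f2 f3"
    "triple f2 f3 f1 = triple f1 f2 f3" "triple f3 f1 f2 = triple f1 f2 f3"
    "triple f3 f2 f1 = - triple f1 f2 f3"
    by (simp_all add: coord3 algebra_simps)
  \<comment> \<open>The determinant of left multiplication by \<open>s x0 + t1 x1 + t2 x2\<close> in the bases \<open>e1, e2, k\<close>
    and \<open>f1, f2, f3\<close>.\<close>
  have det: "s * (t1 * (r1 * t1 + s1 * t2) + t2 * (r2 * t1 + s2 * t2))
      = t1 * ((M21 * t1 + N21 * t2) * (r2 * t1 + s2 * t2) - (M22 * t1 + N22 * t2) * (r1 * t1 + s1 * t2))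
      - t2 * ((M11 * t1 + N11 * t2) * (r2 * t1 + s2 * t2) - (M12 * t1 + N12 * t2) * (r1 * t1 + s1 * t2))"
    (is "s * ?c t1 t2 = ?d t1 t2") for s t1 t2
  proof -
    have "triple ((s *s x0 + t1 *s x1 + t2 *s x2) \<odot> e1) ((s *s x0 + t1 *s x1 + t2 *s x2) \<odot> e2)
      ((s *s x0 + t1 *s x1 + t2 *s x2) \<odot> k) = 0" by (rule triple_prod)
    also have "triple ((s *s x0 + t1 *s x1 + t2 *s x2) \<odot> e1) ((s *s x0 + t1 *s x1 + t2 *s x2) \<odot> e2)
      ((s *s x0 + t1 *s x1 + t2 *s x2) \<odot> k)
      = triple f1 f2 f3 * (?d t1 t2 - s * ?c t1 t2)"
      by (simp add: prods sw algebra_simps del: triple_prod)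
    finally show ?thesis using f3 by simp
  qed
  \<comment> \<open>The identity is affine in \<open>s\<close>, so \<open>s = 0\<close> and
    \<open>s = 1\<close> separate its two parts.\<close>
  have d0: "?d t1 t2 = 0" for t1 t2 using det[of 0 t1 t2] by simp
  have c0: "?c t1 t2 = 0" for t1 t2 using det[of 1 t1 t2] d0[of t1 t2] by simp
  \<comment> \<open>The quadratic form \<open>?c\<close> vanishes, so the matrix of its coefficients
    is alternating.\<close>
  have r1: "r1 = 0" using c0[of 1 0] by simp
  have s2: "s2 = 0" using c0[of 0 1] by simp
  have s1: "s1 = - r2" using c0[of 1 1] r1 s2 by (simp add: eq_neg_iff_add_eq_0)
  \<comment> \<open>Otherwise every product lies in the plane of \<open>f1\<close> and
    \<open>f2\<close>.\<close>
  have r2: "r2 \<noteq> 0"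
  proof
    assume "r2 = 0"
    then have "dot3 (cross f1 f2) (x \<odot> y) = 0" for x y
      unfolding triple_def[symmetric]
      by (subst cramer[OF Dx, of x], subst cramer[OF De, of y]) (simp add: prods r1 s1 s2)
    moreover have "cross f1 f2 \<noteq> 0" using x12 by (simp add: f1_def f2_def)
    ultimately show False using spanning by blast
  qed
  have "M21 + (N21 + M22 - M11) * t + (N22 - N11 - M12) * t^2 + (- N12) * t^3 = 0" for t
  proof -
    have "r2 * (M21 + (N21 + M22 - M11) * t + (N22 - N11 - M12) * t^2 + (- N12) * t^3) = ?d 1 t"
      by (simp add: r1 s1 s2 algebra_simps power2_eq_square power3_eq_cube)
    with d0[of 1 t] r2 show ?thesis by simp
  qed
  from cubic_vanishes[OF inf this]
  have M: "M21 = 0" "N12 = 0" "M11 = N21 + M22" "N22 = N11 + M12" by (auto simp: algebra_simps)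
  define S T1 T2 where "S x = triple x x1 x2 / triple x0 x1 x2"
    and "T1 x = triple x0 x x2 / triple x0 x1 x2" and "T2 x = triple x0 x1 x / triple x0 x1 x2" for x
  \<comment> \<open>By the relations \<open>M\<close>, the terms in \<open>e1\<close> and
    \<open>e2\<close> contribute
    \<open>(S x + M11 * T1 x + N22 * T2 x) *s (T1 x *s f1 + T2 x *s f2)\<close>. Since
    \<open>x \<odot> k = T1 x *s f1 + T2 x *s f2\<close>, the coefficient of \<open>k\<close>
    cancels this.\<close>
  define T where "T x = (- (S x + M11 * T1 x + N22 * T2 x)) *s k + T1 x *s e1 + T2 x *s e2" for x
  have X: "x = S x *s x0 + T1 x *s x1 + T2 x *s x2" for x
    unfolding S_def T1_def T2_def by (rule cramer[OF Dx])
  have lin: "S (x + y) = S x + S y" "T1 (x + y) = T1 x + T1 y" "T2 (x + y) = T2 x + T2 y"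
    "S (c *s x) = c * S x" "T1 (c *s x) = c * T1 x" "T2 (c *s x) = c * T2 x" for x y c
    by (simp_all add: S_def T1_def T2_def add_divide_distrib)
  show thesis
  proof
    show "Vector_Spaces.linear (*s) (*s) T"
      unfolding Vector_Spaces.linear_iff
      by (simp add: vec.vector_space_axioms T_def lin algebra_simps vec_eq_iff)
    show "x = 0" if "T x = 0" for x
    proof -
      have z: "(- (S x + M11 * T1 x + N22 * T2 x)) *s k + T1 x *s e1 + T2 x *s e2 = 0"
        using that by (simp add: T_def)
      have "T1 x = 0" using arg_cong[OF z, of "\<lambda>u. triple k u e2"] De by simp
      moreover have "T2 x = 0" using arg_cong[OF z, of "\<lambda>u. triple k e1 u"] De by simp
      moreover have "S x + M11 * T1 x + N22 * T2 x = 0"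
        using arg_cong[OF z, of "\<lambda>u. triple u e1 e2"] De by (simp add: add_eq_0_iff)
      ultimately show "x = 0" using X[of x] by simp
    qed
    show "x \<odot> T x = 0" for x
    proof -
      have "(s *s x0 + t1 *s x1 + t2 *s x2) \<odot> ((- (s + M11 * t1 + N22 * t2)) *s k + t1 *s e1 + t2 *s e2)
        = 0" for s t1 t2
        by (simp add: prods r1 s1 s2 M vec_eq_iff algebra_simps)
      from this[of "S x" "T1 x" "T2 x"] X[of x] show ?thesis by (simp only: T_def flip: X)
    qed
  qed
qed

end

section \<open>Quotients and tensor products\<close>

text \<open>A basis of \<open>R\<close> is extended to the whole space, and \<open>q\<close> reads
  the coordinates along the three added vectors. With \<open>R = {0}\<close> the same lemma yields
  coordinates on \<open>V\<close>.\<close>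

lemma ex_quotient_map:
  fixes s :: "'k::field \<Rightarrow> 'a::ab_group_add \<Rightarrow> 'a"
  assumes s: "vector_space s" and R: "module.subspace s R"
    and d: "vector_space.dim s UNIV = vector_space.dim s R + 3"
  obtains q :: "'a \<Rightarrow> 'k ^ 3"
  where "Vector_Spaces.linear s (*s) q" "surj q" "\<And>w. q w = 0 \<longleftrightarrow> w \<in> R"
proof -
  interpret vector_space s by (rule s)
  obtain B where B: "B \<subseteq> R" "independent B" "R \<subseteq> span B" "card B = dim R"
    using basis_exists by blast
  have sB: "span B = R" using B R span_minimal by blast
  define E where "E = extend_basis B"
  have E: "B \<subseteq> E" "independent E" "span E = UNIV"
    using B(2) by (simp_all add: E_def extend_basis_superset independent_extend_basis)
  have cE: "card E = dim R + 3" using d dim_eq_card[of E UNIV] E by simp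
  \<comment> \<open>Infinite sets have \<open>card\<close> 0, so the summand 3 forces
    finiteness.\<close>
  then have fE: "finite E" by (metis add_is_0 card.infinite zero_neq_numeral)
  have "card (E - B) = 3" using cE B(4) E(1) fE by (simp add: card_Diff_subset finite_subset)
  then obtain c1 c2 c3 where c: "E - B = {c1, c2, c3}" "c1 \<noteq> c2" "c1 \<noteq> c3" "c2 \<noteq> c3"
    by (metis card_3_iff)
  define rp where "rp = representation E"
  interpret VK: vector_space_pair s "(*) :: 'k \<Rightarrow> 'k \<Rightarrow> 'k"
    by (intro vector_space_pair.intro s vector_space_field)
  have rl: "Vector_Spaces.linear s (*) (\<lambda>w. rp w b)" for b
    unfolding rp_def by (rule linear_representation[OF E(2,3)])
  note rs = VK.linear_add[OF rl] VK.linear_scale[OF rl]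
  have rb: "rp b b' = (if b' = b then 1 else 0)" if "b \<in> E" for b b'
    unfolding rp_def by (simp add: representation_basis[OF E(2) that])
  have cE': "c1 \<in> E" "c2 \<in> E" "c3 \<in> E" and cB: "c1 \<notin> B" "c2 \<notin> B" "c3 \<notin> B" using c(1) by auto
  define q :: "'a \<Rightarrow> 'k ^ 3" where "q w = vector [rp w c1, rp w c2, rp w c3]" for w
  show thesis
  proof
    show "Vector_Spaces.linear s (*s) q"
      by (simp add: Vector_Spaces.linear_iff s vec.vector_space_axioms q_def rs vec_eq_iff forall_3)
    show "surj q"
    proof (rule surjI)
      fix v :: "'k ^ 3"
      show "q (s (v $ 1) c1 + s (v $ 2) c2 + s (v $ 3) c3) = v"
        using c(2-4) by (simp add: q_def rs rb cE' vec_eq_iff forall_3)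
    qed
    show "q w = 0 \<longleftrightarrow> w \<in> R" for w
    proof
      assume w: "w \<in> R"
      have "rp w c = 0" if "c \<notin> B" for c
      proof (rule VK.linear_eq_on[OF rl VK.linear_zero])
        show "w \<in> span B" using w sB by simp
        show "rp b c = 0" if "b \<in> B" for b using that E(1) rb \<open>c \<notin> B\<close> by auto
      qed
      then show "q w = 0" using cB by (simp add: q_def vec_eq_iff forall_3)
    next
      assume "q w = 0"
      then have z: "rp w c1 = 0" "rp w c2 = 0" "rp w c3 = 0"
        by (simp_all add: q_def vec_eq_iff forall_3)
      have "s (rp w b) b \<in> span B" if "b \<in> E" for b
      proof (cases "b \<in> B")
        case False
        with that c(1) have "b \<in> {c1, c2, c3}" by blast
        with z show ?thesis by (auto simp: span_zero)
      qed (simp add: span_base span_scale)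
      then have "(\<Sum>b\<in>E. s (rp w b) b) \<in> span B" by (rule span_sum)
      then show "w \<in> R"
        using sum_representation_eq[OF E(2) _ fE order.refl, of w] E(3) sB by (simp add: rp_def)
    qed
  qed
qed

text \<open>Positivity of \<open>m\<close> and \<open>n\<close> rules out infinite bases, whose
  \<open>card\<close> is 0 by convention.\<close>

lemma dim_tensor_product:
  assumes T: "is_tensor_product s1 s2 sW t"
    and d: "vector_space.dim s1 UNIV = m" "vector_space.dim s2 UNIV = n" "m > 0" "n > 0"
  obtains E where "finite_dimensional_vector_space sW E" "vector_space.dim sW UNIV = m * n"
proof -
  have bt: "bilinear_map s1 s2 sW t" using T by (simp add: is_tensor_product_def)
  interpret V1: vector_space s1 by (rule bilinear_map_vector_spaces(1)[OF bt])
  interpret V2: vector_space s2 by (rule bilinear_map_vector_spaces(2)[OF bt])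
  interpret W: vector_space sW by (rule bilinear_map_vector_spaces(3)[OF bt])
  obtain B where B0: "V1.independent B" "UNIV \<subseteq> V1.span B" "card B = m"
    using V1.basis_exists d by metis
  obtain C where C0: "V2.independent C" "UNIV \<subseteq> V2.span C" "card C = n"
    using V2.basis_exists d by metis
  have B: "V1.span B = UNIV" and C: "V2.span C = UNIV" using B0 C0 by auto
  have fin: "finite B" "finite C" using B0 C0 d by (auto intro: card_ge_0_finite)
  let ?E = "(\<lambda>(b, c). t b c) ` (B \<times> C)"
  note E = tensor_product_basis[OF T B0(1) B C0(1) C]
  show thesis
  proof
    show "finite_dimensional_vector_space sW ?E"
      by unfold_locales (use fin E in auto)
    show "W.dim UNIV = m * n"
      using W.dim_eq_card[of ?E UNIV] E B0 C0 by (simp add: card_image card_cartesian_product)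
  qed
qed

text \<open>The tensor product has dimension 9 and is spanned by the graph tensors together with
  three more.\<close>

lemma dim_span_graph:
  assumes T: "is_tensor_product s s sW t" and d: "vector_space.dim s UNIV = 3"
    and f: "Vector_Spaces.linear s s f" "surj f"
  shows "6 \<le> vector_space.dim sW (module.span sW {t x (f x) | x. True})"
proof -
  have bt: "bilinear_map s s sW t" using T by (simp add: is_tensor_product_def)
  interpret V: vector_space s by (rule bilinear_map_vector_spaces(1)[OF bt])
  obtain E where E: "finite_dimensional_vector_space sW E" "vector_space.dim sW UNIV = 3 * 3"
    using dim_tensor_product[OF T d d] by auto
  interpret W: finite_dimensional_vector_space sW E by (rule E(1))
  interpret VW: vector_space_pair s sW ..
  interpret VV: vector_space_pair s s ..
  have tl: "Vector_Spaces.linear s sW (t x)" "Vector_Spaces.linear s sW (\<lambda>x. t x y)" for x y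
    using bt by (auto simp: bilinear_map_def)
  note simps = VW.linear_add[OF tl(1)] VW.linear_add[OF tl(2)] VW.linear_scale[OF tl(1)]
    VW.linear_scale[OF tl(2)] VW.linear_0[OF tl(1)] VW.linear_0[OF tl(2)]
    VV.linear_add[OF f(1)] VV.linear_scale[OF f(1)] VV.linear_0[OF f(1)]
  obtain B where B0: "UNIV \<subseteq> V.span B" "card B = 3"
    using V.basis_exists d by metis
  obtain b1 b2 b3 where b: "B = {b1, b2, b3}" using B0(2) by (metis card_3_iff)
  let ?S = "{t x (f x) | x. True}" and ?Z = "{t b1 (f b2), t b1 (f b3), t b2 (f b3)}"
  \<comment> \<open>Modulo \<open>?S\<close>, \<open>t x (f y)\<close> is alternating, so the three elements of \<open>?Z\<close> span the quotient.\<close>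
  obtain C where C: "C \<subseteq> W.span ?S" "W.independent C" "W.span ?S \<subseteq> W.span C"
      "card C = W.dim (W.span ?S)"
    using W.basis_exists by blast
  let ?P = "W.span (C \<union> ?Z)"
  have diag: "t x (f x) \<in> ?P" for x
  proof -
    have "t x (f x) \<in> W.span C" using C(3) W.span_base[of "t x (f x)" ?S] by blast
    then show ?thesis using W.span_mono[of C "C \<union> ?Z"] by blast
  qed
  \<comment> \<open>Polarisation of the diagonal tensors.\<close>
  have swap: "t y (f x) \<in> ?P" if "t x (f y) \<in> ?P" for x y
  proof -
    have "t y (f x) = t (x + y) (f (x + y)) - t x (f x) - t y (f y) - t x (f y)"
      by (simp add: simps)
    then show ?thesis using diag that by (metis W.span_diff)
  qed
  have 1: "t b (f b') \<in> ?P" if "b \<in> B" "b' \<in> B" for b b'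
    using that diag swap W.span_base[of _ "C \<union> ?Z"] unfolding b by auto
  have 2: "t b (f y) \<in> ?P" if "b \<in> B" for b y
  proof -
    have "V.subspace {y. t b (f y) \<in> ?P}"
      by (auto simp: V.subspace_def simps W.span_zero W.span_add W.span_scale)
    then have "V.span B \<subseteq> {y. t b (f y) \<in> ?P}" using 1 that by (intro V.span_minimal) auto
    with B0 show ?thesis by blast
  qed
  have 3: "t x (f y) \<in> ?P" for x y
  proof -
    have "V.subspace {x. t x (f y) \<in> ?P}"
      by (auto simp: V.subspace_def simps W.span_zero W.span_add W.span_scale)
    then have "V.span B \<subseteq> {x. t x (f y) \<in> ?P}" using 2 by (intro V.span_minimal) auto
    with B0 show ?thesis by blast
  qed
  have "{t x y | x y. True} \<subseteq> ?P" using 3 f(2) by (auto simp: surj_def) metis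
  then have "W.span {t x y | x y. True} \<subseteq> ?P" by (intro W.span_minimal W.subspace_span)
  then have "UNIV \<subseteq> ?P" using tensor_product_spans[OF T] by simp
  then have "W.dim UNIV \<le> card (C \<union> ?Z)"
    using W.finiteI_independent[OF C(2)] by (intro W.dim_le_card) auto
  also have "\<dots> \<le> card C + card ?Z" by (rule card_Un_le)
  also have "card ?Z \<le> 3" by (simp add: card_insert_if)
  finally show ?thesis using E(2) C(4) by simp
qed

text \<open>Scalars move across the tensor sign, so the generators already form the image of a
  linear map.\<close>

lemma tensor_subspace_line:
  assumes "bilinear_map s1 s2 sW t"
  shows "tensor_subspace sW t UNIV (module.span s2 {y}) = range (\<lambda>x. t x y)"
    and "tensor_subspace sW t (module.span s1 {x}) UNIV = range (t x)"
proof -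
  interpret V1: vector_space s1 by (rule bilinear_map_vector_spaces(1)[OF assms])
  interpret V2: vector_space s2 by (rule bilinear_map_vector_spaces(2)[OF assms])
  interpret W: vector_space sW by (rule bilinear_map_vector_spaces(3)[OF assms])
  interpret l: module_hom s2 sW "t x" for x
    using assms by (simp add: bilinear_map_def module_hom_iff_linear)
  interpret r: module_hom s1 sW "\<lambda>x. t x y" for y
    using assms by (simp add: bilinear_map_def module_hom_iff_linear)
  have eq: "t x (s2 c y) = t (s1 c x) y" for c x y by (simp add: l.scale r.scale)
  have "{t x' y' | x' y'. x' \<in> UNIV \<and> y' \<in> V2.span {y}} = range (\<lambda>x. t x y)"
    by (auto simp: V2.span_singleton eq) (metis V2.scale_one rangeI)
  then show "tensor_subspace sW t UNIV (V2.span {y}) = range (\<lambda>x. t x y)"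
    by (simp add: tensor_subspace_def W.span_eq_iff r.subspace_image)
  have "{t x' y' | x' y'. x' \<in> V1.span {x} \<and> y' \<in> UNIV} = range (t x)"
    by (auto simp: V1.span_singleton eq[symmetric]) (metis V1.scale_one rangeI)
  then show "tensor_subspace sW t (V1.span {x}) UNIV = range (t x)"
    by (simp add: tensor_subspace_def W.span_eq_iff l.subspace_image)
qed

text \<open>Subtracting from \<open>w\<close> the value \<open>g u\<close> with
  \<open>q (g u) = q w\<close> leaves an element of the kernel \<open>R\<close>; injectivity of
  \<open>q \<circ> g\<close> makes the intersection trivial.\<close>

lemma internal_direct_sum_kernel:
  assumes q: "Vector_Spaces.linear sW sQ q" "\<And>w. q w = 0 \<longleftrightarrow> w \<in> R"
    and g: "Vector_Spaces.linear sU sW g" "bij (q \<circ> g)"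
  shows "internal_direct_sum (range g) R UNIV"
proof -
  interpret q: Vector_Spaces.linear sW sQ q by (rule q(1))
  interpret g: Vector_Spaces.linear sU sW g by (rule g(1))
  have "w \<in> {x + r | x r. x \<in> range g \<and> r \<in> R}" for w
  proof -
    obtain u where "q w = (q \<circ> g) u" using surjD[OF bij_is_surj[OF g(2)]] by blast
    then have "q (w - g u) = 0" by (simp add: q.diff)
    then have "w - g u \<in> R" by (simp only: q(2))
    moreover have "w = g u + (w - g u)" by simp
    ultimately show ?thesis by blast
  qed
  moreover have "w = 0" if w: "w \<in> range g" "w \<in> R" for w
  proof -
    obtain u where u: "w = g u" using w(1) by blast
    then have "(q \<circ> g) u = (q \<circ> g) 0" using w(2) by (simp add: q(2) g.zero q.zero)
    then show ?thesis using bij_is_inj[OF g(2)] u g.zero by (metis injD)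
  qed
  moreover have "0 \<in> range g" "0 \<in> R"
    using g.zero q.zero q(2)[of 0] by (metis rangeI, simp)
  ultimately show ?thesis unfolding internal_direct_sum_def by blast
qed

section \<open>Reduction of the trichotomy to the coordinate product\<close>

theorem lemma1p4:
  fixes scaleV :: "'k::field \<Rightarrow> 'v::ab_group_add \<Rightarrow> 'v"
    and scaleW :: "'k \<Rightarrow> 'w::ab_group_add \<Rightarrow> 'w"
    and tensor :: "'v \<Rightarrow> 'v \<Rightarrow> 'w" (infixr "\<otimes>" 70)
    and R :: "'w set"
  assumes "infinite (UNIV :: 'k set)"
    and "vector_space scaleV" and "vector_space.dim scaleV UNIV = 3"
    and "is_tensor_product scaleV scaleV scaleW (\<otimes>)"
    and "module.subspace scaleW R" and "vector_space.dim scaleW R = 6"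
  shows
    "(\<exists>L. module.subspace scaleV L \<and> vector_space.dim scaleV L = 1 \<and>
        (internal_direct_sum (tensor_subspace scaleW (\<otimes>) UNIV L) R UNIV \<or>
         internal_direct_sum (tensor_subspace scaleW (\<otimes>) L UNIV) R UNIV)) \<or>
     (\<exists>L. module.subspace scaleV L \<and> vector_space.dim scaleV L = 1 \<and>
        (tensor_subspace scaleW (\<otimes>) UNIV L \<subseteq> R \<or>
         tensor_subspace scaleW (\<otimes>) L UNIV \<subseteq> R)) \<or>
     (\<exists>T. Vector_Spaces.linear scaleV scaleV T \<and> bij T \<and>
        R = module.span scaleW {x \<otimes> T x | x. True})"
    (is "?P1 \<or> ?P2 \<or> ?P3")
proof (cases "?P1 \<or> ?P2")
  case False
  have bt: "bilinear_map scaleV scaleV scaleW (\<otimes>)" using assms(4) by (simp add: is_tensor_product_def)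
  interpret V: vector_space scaleV by (rule assms(2))
  obtain E where E: "finite_dimensional_vector_space scaleW E" "vector_space.dim scaleW UNIV = 3 * 3"
    using dim_tensor_product[OF assms(4,3,3)] by auto
  interpret W: finite_dimensional_vector_space scaleW E by (rule E(1))
  have tl: "Vector_Spaces.linear scaleV scaleW ((\<otimes>) x)"
    "Vector_Spaces.linear scaleV scaleW (\<lambda>x. x \<otimes> y)" for x y
    using bt by (auto simp: bilinear_map_def)
  obtain q :: "'w \<Rightarrow> 'k ^ 3" where q: "Vector_Spaces.linear scaleW (*s) q" "surj q"
      "\<And>w. q w = 0 \<longleftrightarrow> w \<in> R"
    by (rule ex_quotient_map[OF W.vector_space_axioms assms(5)]) (use E(2) assms(6) in auto)
  have "V.dim UNIV = V.dim {0} + 3" using assms(3) V.dim_eq_card_independent[of "{}"]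
    by (metis V.dim_span V.independent_empty V.span_empty add_0 card.empty)
  then obtain p :: "'v \<Rightarrow> 'k ^ 3" where p: "Vector_Spaces.linear scaleV (*s) p" "surj p"
      "\<And>v. p v = 0 \<longleftrightarrow> v = 0"
    using ex_quotient_map[OF V.vector_space_axioms V.subspace_single_0] by auto
  interpret p: Vector_Spaces.linear scaleV "(*s)" p by (rule p(1))
  interpret q: Vector_Spaces.linear scaleW "(*s)" q by (rule q(1))
  have bp: "bij p" using p(2,3) by (simp add: bij_def p.inj_iff_eq_0)
  define r where "r = inv p"
  have rp [simp]: "r (p v) = v" "p (r x) = x" for v x
    using bp by (simp_all add: r_def bij_is_inj bij_is_surj surj_f_inv_f)
  have br: "bij r" unfolding r_def by (rule bij_imp_bij_inv[OF bp])
  have lr: "Vector_Spaces.linear (*s) scaleV r"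
    unfolding Vector_Spaces.linear_iff
    by (auto simp: V.vector_space_axioms vec.vector_space_axioms p.add p.scale
        intro!: injD[OF bij_is_inj[OF bp]])
  interpret r: Vector_Spaces.linear "(*s)" scaleV r by (rule lr)
  define m where "m x y = q (r x \<otimes> r y)" for x y
  have lm: "Vector_Spaces.linear (*s) (*s) (m x)" "Vector_Spaces.linear (*s) (*s) (\<lambda>x. m x y)" for x y
    using Vector_Spaces.linear_compose[OF Vector_Spaces.linear_compose[OF lr tl(1)] q(1)]
      Vector_Spaces.linear_compose[OF Vector_Spaces.linear_compose[OF lr tl(2)] q(1)]
    by (simp_all add: m_def[abs_def] o_def)
  have line: "V.subspace (V.span {v})" "V.dim (V.span {v}) = 1" if "v \<noteq> 0" for v
    using that V.dim_eq_card_independent[of "{v}"] by simp_all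
  have bijI: "bij g" if "Vector_Spaces.linear (*s) (*s) g" "\<not> (\<exists>y. y \<noteq> 0 \<and> g y = 0)"
    for g :: "'k ^ 3 \<Rightarrow> 'k ^ 3"
  proof -
    have "inj g" using that module_hom.inj_iff_eq_0[OF module_hom_linearI[OF that(1)]] by blast
    then show ?thesis using vec.linear_inj_imp_surj[OF that(1)] by (simp add: bij_def)
  qed
  interpret degenerate_product m
  proof
    show "infinite (UNIV :: 'k set)" by (rule assms(1))
    show "bilinear_map (*s) (*s) (*s) m" using lm by (simp add: bilinear_map_def)
    \<comment> \<open>If \<open>m x\<close> were injective for some \<open>x \<noteq> 0\<close>,
      \<open>q\<close> would be bijective on \<open>r x \<otimes> V\<close>, making it a complement
      of \<open>R\<close> as in (P1).\<close>
    show "\<exists>y. y \<noteq> 0 \<and> m x y = 0" for x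
    proof (cases "x = 0")
      case True
      then show ?thesis
        by (intro exI[of _ "axis 1 1"]) (simp add: axis_eq_0_iff module_hom.zero[OF module_hom_linearI[OF lm(2)]])
    next
      case False
      show ?thesis
      proof (rule ccontr)
        assume "\<not> ?thesis"
        with lm(1) have "bij (m x)" by (rule bijI)
        then have "bij (m x \<circ> p)" by (rule bij_comp[OF bp])
        moreover have "m x \<circ> p = q \<circ> (\<otimes>) (r x)" by (simp add: fun_eq_iff m_def)
        ultimately have "internal_direct_sum (range ((\<otimes>) (r x))) R UNIV"
          by (intro internal_direct_sum_kernel[OF q(1,3) tl(1)]) simp_all
        moreover have "r x \<noteq> 0" using False by (metis p.zero rp(2))
        ultimately show False using \<open>\<not> (?P1 \<or> ?P2)\<close> line tensor_subspace_line(2)[OF bt] by metis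
      qed
    qed
    show "\<exists>x. x \<noteq> 0 \<and> m x y = 0" for y
    proof (cases "y = 0")
      case True
      then show ?thesis
        by (intro exI[of _ "axis 1 1"]) (simp add: axis_eq_0_iff module_hom.zero[OF module_hom_linearI[OF lm(1)]])
    next
      case False
      show ?thesis
      proof (rule ccontr)
        assume "\<not> ?thesis"
        with lm(2) have "bij (\<lambda>x. m x y)" by (rule bijI)
        then have "bij ((\<lambda>x. m x y) \<circ> p)" by (rule bij_comp[OF bp])
        moreover have "(\<lambda>x. m x y) \<circ> p = q \<circ> (\<lambda>x. x \<otimes> r y)" by (simp add: fun_eq_iff m_def)
        ultimately have "internal_direct_sum (range (\<lambda>x. x \<otimes> r y)) R UNIV"
          by (intro internal_direct_sum_kernel[OF q(1,3) tl(2)]) simp_all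
        moreover have "r y \<noteq> 0" using False by (metis p.zero rp(2))
        ultimately show False using \<open>\<not> (?P1 \<or> ?P2)\<close> line tensor_subspace_line(1)[OF bt] by metis
      qed
    qed
    \<comment> \<open>If \<open>m x\<close> vanished, \<open>R\<close> would contain
      \<open>r x \<otimes> V\<close>, which is (P2).\<close>
    show "\<exists>y. m x y \<noteq> 0" if "x \<noteq> 0" for x
    proof (rule ccontr)
      assume *: "\<not> ?thesis"
      have "r x \<otimes> v \<in> R" for v using * rp(1)[of v] by (metis m_def q(3))
      then have "range ((\<otimes>) (r x)) \<subseteq> R" by blast
      moreover have "r x \<noteq> 0" using that by (metis p.zero rp(2))
      ultimately show False using False line tensor_subspace_line(2)[OF bt] by metis
    qed
    show "\<exists>x. m x y \<noteq> 0" if "y \<noteq> 0" for y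
    proof (rule ccontr)
      assume *: "\<not> ?thesis"
      have "v \<otimes> r y \<in> R" for v using * rp(1)[of v] by (metis m_def q(3))
      then have "range (\<lambda>v. v \<otimes> r y) \<subseteq> R" by blast
      moreover have "r y \<noteq> 0" using that by (metis p.zero rp(2))
      ultimately show False using False line tensor_subspace_line(1)[OF bt] by metis
    qed
    \<comment> \<open>A functional killing all products kills \<open>q\<close> on pure tensors,
      hence on all of \<open>W\<close>, and \<open>q\<close> is onto.\<close>
    show "\<exists>x y. dot3 c (m x y) \<noteq> 0" if "c \<noteq> 0" for c
    proof (rule ccontr)
      assume *: "\<not> ?thesis"
      have "dot3 c (q (v \<otimes> v')) = 0" for v v'
        using * rp(1)[of v] rp(1)[of v'] by (metis m_def)
      then have sub: "{v \<otimes> v' | v v'. True} \<subseteq> {w. dot3 c (q w) = 0}" by blast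
      have "W.subspace {w. dot3 c (q w) = 0}"
        by (auto simp: W.subspace_def q.add q.scale q.zero)
      with sub have "dot3 c (q w) = 0" for w
        using W.span_minimal tensor_product_spans[OF assms(4)] by blast
      then have "dot3 c v = 0" for v using q(2) by (metis surj_def)
      from this[of "axis 1 1"] this[of "axis 2 1"] this[of "axis 3 1"] that show False
        by (simp add: coord3 axis_def)
    qed
  qed
  obtain T where T: "Vector_Spaces.linear (*s) (*s) T" "\<And>x. T x = 0 \<Longrightarrow> x = 0" "\<And>x. m x (T x) = 0"
    using ex_annihilating_map by metis
  define T' where "T' = r \<circ> T \<circ> p"
  have "bij T" using T by (intro bijI) auto
  then have bT: "bij T'" unfolding T'_def by (intro bij_comp bp br)
  have lT: "Vector_Spaces.linear scaleV scaleV T'"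
    unfolding T'_def by (intro Vector_Spaces.linear_compose[of _ "(*s)"] lr T(1) p(1))
  let ?S = "W.span {x \<otimes> T' x | x. True}"
  have "x \<otimes> T' x \<in> R" for x using T(3)[of "p x"] by (simp add: T'_def m_def q(3))
  then have "?S \<subseteq> R" using assms(5) by (intro W.span_minimal) auto
  \<comment> \<open>The lower bound 6 meets the dimension of \<open>R\<close>, so the inclusion is
    an equality.\<close>
  moreover have "W.dim R \<le> W.dim ?S"
    using dim_span_graph[OF assms(4,3) lT bij_is_surj[OF bT]] assms(6) by simp
  ultimately have "?S = R" using assms(5) by (intro W.subspace_dim_equal W.subspace_span)
  with lT bT show ?thesis by blast
qed blast

end
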